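(* Let $G=(V,E)$ with $V=[n]$ be a cactus graph with exactly $k$ cycles, let $\boldsymbol{a}=(a_{ij})_{ij\in E}$ be any vector of nonzero real edge weights, and let $f:[0,1]^n\to\mathbb{R}$, $f(\boldsymbol{x})=\sum_{ij\in E}a_{ij}x_ix_j$. Then $X(f)$ is described by the McCormick inequalities and at most $2k$ cycle inequalities; that is, $X(f)=\pi[f](P)$ for some polytope $P$ in the space of variables $(x_i)_{i\in V},(y_{ij})_{ij\in E}$ that is described by the McCormick inequalities for all $ij\in E$ together with at most $2k$ cycle inequalities.
   Context: A cactus graph is a (finite, simple) graph whose cycles are edge-disjoint, i.e. every edge is contained in at most one cycle (equivalently, any two cycles have at most one common vertex). $X(f)=\operatorname{conv}\{(\boldsymbol{x},z)\in[0,1]^n\times\mathbb{R}: z=f(\boldsymbol{x})\}$. The map $\pi[f]:\mathbb{R}^{n+|E|}\to\mathbb{R}^{n+1}$ is $\pi[f](\boldsymbol{x},\boldsymbol{y})=(\boldsymbol{x},\sum_{ij\in E}a_{ij}y_{ij})$, and $\pi[f](P)$ is the image of $P$. All polytopes considered lie in $[0,1]^{n+|E|}$. The McCormick inequalities for $ij\in E$ are $y_{ij}\ge 0$, $y_{ij}\le x_i$, $y_{ij}\le x_j$, $x_i+x_j-y_{ij}\le 1$. A cycle inequality is, for a cycle $C\subseteq E$ (given by its edge set) and a subset $D\subseteq C$ of odd cardinality, the inequality $$x(V_0)-x(V_1)+y(C\setminus D)-y(D)\le\frac{|D|-1}{2},$$ where $V_0=\{u\in V: e\cap\hat e=\{u\}\text{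 for some }e,\hat e\in D\}$, $V_1=\{u\in V: e\cap\hat e=\{u\}\text{ for some }e,\hat e\in C\setminus D\}$, $x(S)=\sum_{i\in S}x_i$ for $S\subseteq V$, and $y(\hat E)=\sum_{ij\in\hat E}y_{ij}$ for $\hat E\subseteq E$. *)

theory Defs
  imports "HOL-Analysis.Analysis"
begin

text \<open>The vertex set is a finite type \<open>'n\<close> (so \<open>n = CARD('n)\<close>), and a graph is given by
  its edge set \<open>E\<close>.\<close>

definition simple_graph :: "'n::finite set set \<Rightarrow> bool" where
  "simple_graph E \<longleftrightarrow> (\<forall>e\<in>E. card e = 2)"

definition closed_walk_edges :: "'n list \<Rightarrow> 'n set set" where
  "closed_walk_edges vs = {{vs ! i, vs ! (Suc i mod length vs)} | i. i < length vs}"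

text \<open>Cycles are identified with their edge sets, so rotations and reversals of the vertex list
  are not counted separately.\<close>

definition cycles :: "'n::finite set set \<Rightarrow> 'n set set set" where
  "cycles E = {C. C \<subseteq> E \<and> (\<exists>vs. distinct vs \<and> 3 \<le> length vs \<and> C = closed_walk_edges vs)}"

text \<open>Connectedness is not part of the notion.\<close>

definition cactus :: "'n::finite set set \<Rightarrow> bool" where
  "cactus E \<longleftrightarrow> simple_graph E \<and>
     (\<forall>e\<in>E. \<forall>C\<in>cycles E. \<forall>C'\<in>cycles E. e \<in> C \<and> e \<in> C' \<longrightarrow> C = C')"

definition quad_fun :: "'n::finite set set \<Rightarrow> ('n set \<Rightarrow> real) \<Rightarrow> real ^ 'n \<Rightarrow> real" where
  "quad_fun E a x = (\<Sum>e\<in>E. a e * (\<Prod>i\<in>e. x $ i))"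

definition hull_graph :: "(real ^ 'n \<Rightarrow> real) \<Rightarrow> ((real ^ 'n::finite) \<times> real) set" where
  "hull_graph f = convex hull {(x, z). (\<forall>i. 0 \<le> x $ i \<and> x $ i \<le> 1) \<and> z = f x}"

text \<open>The space \<open>\<real>\<^bsup>n+|E|\<^esup>\<close> is realised inside \<open>(real ^ 'n) \<times> (real ^ 'n set)\<close> as the subspace of all
  \<open>(x, y)\<close> with \<open>y $ e = 0\<close> for \<open>e \<notin> E\<close>; this also covers \<open>E = {}\<close>, which an index type for the
  edges would exclude.\<close>

definition unit_box :: "'n::finite set set \<Rightarrow> ((real ^ 'n) \<times> (real ^ 'n set)) set" where
  "unit_box E = {(x, y). (\<forall>i. 0 \<le> x $ i \<and> x $ i \<le> 1) \<and>
     (\<forall>e\<in>E. 0 \<le> y $ e \<and> y $ e \<le> 1) \<and> (\<forall>e. e \<notin> E \<longrightarrow> y $ e = 0)}"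

definition proj_map ::
  "'n::finite set set \<Rightarrow> ('n set \<Rightarrow> real) \<Rightarrow> (real ^ 'n) \<times> (real ^ 'n set) \<Rightarrow> (real ^ 'n) \<times> real" where
  "proj_map E a = (\<lambda>(x, y). (x, \<Sum>e\<in>E. a e * y $ e))"

definition mccormick :: "'n::finite set set \<Rightarrow> real ^ 'n \<Rightarrow> (real ^ 'n set) \<Rightarrow> bool" where
  "mccormick E x y \<longleftrightarrow> (\<forall>i j. {i, j} \<in> E \<longrightarrow>
     0 \<le> y $ {i, j} \<and> y $ {i, j} \<le> x $ i \<and> y $ {i, j} \<le> x $ j \<and>
     x $ i + x $ j - y $ {i, j} \<le> 1)"

definition meeting_vertices :: "'n set set \<Rightarrow> 'n set" where
  "meeting_vertices S = {u. \<exists>e\<in>S. \<exists>e'\<in>S. e \<inter> e' = {u}}"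

definition cycle_inequality ::
  "'n::finite set set \<Rightarrow> 'n set set \<Rightarrow> real ^ 'n \<Rightarrow> (real ^ 'n set) \<Rightarrow> bool" where
  "cycle_inequality C D x y \<longleftrightarrow>
     (\<Sum>i\<in>meeting_vertices D. x $ i) - (\<Sum>i\<in>meeting_vertices (C - D). x $ i)
       + (\<Sum>e\<in>C - D. y $ e) - (\<Sum>e\<in>D. y $ e) \<le> (real (card D) - 1) / 2"

text \<open>A cycle inequality is determined by the pair \<open>(C, D)\<close>, and distinct pairs give distinct
  inequalities (compare the coefficients of \<open>y\<close>), so cycle inequalities are counted by pairs.\<close>

definition cycle_ineq_indices :: "'n::finite set set \<Rightarrow> ('n set set \<times> 'n set set) set" where
  "cycle_ineq_indices E = {(C, D). C \<in> cycles E \<and> D \<subseteq> C \<and> odd (card D)}"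

definition described_polytope ::
  "'n::finite set set \<Rightarrow> ('n set set \<times> 'n set set) set \<Rightarrow> ((real ^ 'n) \<times> (real ^ 'n set)) set" where
  "described_polytope E Q = {(x, y) \<in> unit_box E. mccormick E x y \<and>
     (\<forall>(C, D)\<in>Q. cycle_inequality C D x y)}"

end

theory Submission
  imports Defs "HOL-Probability.Probability_Measure"
begin

text \<open>It suffices to find, over each \<open>(x, y)\<close> in the polytope, a hull point \<open>(x, z)\<close> with
  \<open>z \<ge> \<Sum> a e * y e\<close>; a lower one follows by passing to \<open>- a\<close>. Such a point comes from a random vertex:
  put an arc of length \<open>x i\<close> on a circle of circumference 1 around a centre \<open>\<theta> i\<close>, choose a point of the
  circle uniformly, and take the set of all \<open>i\<close> whose arc contains it. Let \<open>g\<close> be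
  \<open>(x i + x j) / 2 - y {i, j}\<close>. Under the McCormick inequalities, \<open>i\<close> and \<open>j\<close> are chosen together with
  probability at least \<open>y {i, j}\<close> if their centres have circular distance at most \<open>g\<close>, and with
  probability at most \<open>y {i, j}\<close> if \<open>\<theta> i\<close> is within \<open>1/2 - g\<close> of the antipode of \<open>\<theta> j\<close>. So positive
  edges ask for nearby and negative edges for nearly antipodal centres. Around a cycle with evenly many
  negative edges this can be done exactly; with oddly many the total tolerance must be at least
  \<open>1/2\<close>, which is precisely the cycle inequality for the set \<open>D\<close> of negative edges. In a cactus the
  cycles can be treated one at a time, because removing a cycle disconnects its vertices from each
  other and the resulting pieces can be rotated independently.\<close>

subsection \<open>Polytopes\<close>

lemma polyhedron_linear_le:
  fixes l :: "'a::euclidean_space \<Rightarrow> real"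
  assumes "linear l"
  shows "polyhedron {z. l z \<le> b}"
proof -
  have "l z = adjoint l 1 \<bullet> z" for z
    using adjoint_works[OF assms, of z 1] by (simp add: inner_commute)
  then show ?thesis
    by (simp add: polyhedron_halfspace_le)
qed

lemma polyhedron_Ball:
  assumes "finite I" "\<And>i. i \<in> I \<Longrightarrow> polyhedron {z. P i z}"
  shows "polyhedron {z. \<forall>i\<in>I. P i z}"
proof -
  have "{z. \<forall>i\<in>I. P i z} = \<Inter> ((\<lambda>i. {z. P i z}) ` I)"
    by auto
  then show ?thesis
    using assms by (auto intro!: polyhedron_Inter)
qed

lemma polyhedron_imp:
  assumes "Q \<Longrightarrow> polyhedron {z. P z}"
  shows "polyhedron {z. Q \<longrightarrow> P z}"
  using assms by (cases Q) auto

lemma polyhedron_conj: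
  assumes "polyhedron {z. P z}" "polyhedron {z. Q z}"
  shows "polyhedron {z. P z \<and> Q z}"
  using polyhedron_Int[OF assms] by (simp add: Collect_conj_eq)

lemma polyhedron_affine_le:
  fixes l r :: "'a::euclidean_space \<Rightarrow> real"
  assumes "linear l" "linear r"
  shows "polyhedron {z. l z + c \<le> r z + d}"
  using polyhedron_linear_le[OF linear_compose_sub[OF assms], of "d - c"]
  by (simp add: algebra_simps)

lemma linear_coord_fst: "linear (\<lambda>z. fst z $ i)"
  by (intro linearI) auto

lemma linear_coord_snd: "linear (\<lambda>z. snd z $ i)"
  by (intro linearI) auto

lemma linear_sum_coord_fst: "linear (\<lambda>z. \<Sum>i\<in>S. fst z $ i)"
  by (intro linearI) (auto simp: sum.distrib scaleR_sum_right)

lemma linear_sum_coord_snd: "linear (\<lambda>z. \<Sum>i\<in>S. snd z $ i)"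
  by (intro linearI) (auto simp: sum.distrib scaleR_sum_right)

lemma polytope_described_polytope:
  fixes E :: "'n::finite set set"
  shows "polytope (described_polytope E Q)"
proof -
  note lin = linear_compose_add linear_compose_sub linear_coord_fst linear_coord_snd
    linear_sum_coord_fst linear_sum_coord_snd linear_zero
  have le0: "polyhedron {z. l z \<le> r z}" if "linear l" "linear r"
    for l r :: "(real ^ 'n) \<times> (real ^ 'n set) \<Rightarrow> real"
    using polyhedron_affine_le[OF that, of 0 0] by simp
  have lec: "polyhedron {z. l z \<le> c}" if "linear l"
    for l :: "(real ^ 'n) \<times> (real ^ 'n set) \<Rightarrow> real" and c
    using polyhedron_linear_le[OF that] .
  have cle: "polyhedron {z. 0 \<le> l z}" if "linear l"
    for l :: "(real ^ 'n) \<times> (real ^ 'n set) \<Rightarrow> real"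
    using le0[OF linear_zero that] by simp
  have eq0: "r = 0 \<longleftrightarrow> r \<le> 0 \<and> 0 \<le> r" for r :: real
    by auto
  \<comment> \<open>Equations are split into two inequalities and all quantifiers range over finite
    sets, so only finitely many halfspaces are intersected.\<close>
  have "polyhedron {z :: (real ^ 'n) \<times> (real ^ 'n set).
      ((\<forall>i\<in>UNIV. 0 \<le> fst z $ i \<and> fst z $ i \<le> 1) \<and>
       (\<forall>e\<in>E. 0 \<le> snd z $ e \<and> snd z $ e \<le> 1) \<and>
       (\<forall>e\<in>UNIV. e \<notin> E \<longrightarrow> snd z $ e \<le> 0 \<and> 0 \<le> snd z $ e)) \<and>
      (\<forall>i\<in>UNIV. \<forall>j\<in>UNIV. {i, j} \<in> E \<longrightarrow>
         0 \<le> snd z $ {i, j} \<and> snd z $ {i, j} \<le> fst z $ i \<and> snd z $ {i, j} \<le> fst z $ j \<and>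
         fst z $ i + fst z $ j - snd z $ {i, j} \<le> 1) \<and>
      (\<forall>q\<in>Q. (\<Sum>i\<in>meeting_vertices (snd q). fst z $ i)
          - (\<Sum>i\<in>meeting_vertices (fst q - snd q). fst z $ i)
          + (\<Sum>e\<in>fst q - snd q. snd z $ e) - (\<Sum>e\<in>snd q. snd z $ e)
          \<le> (real (card (snd q)) - 1) / 2)}" (is "polyhedron ?H")
    by (intro polyhedron_conj polyhedron_Ball polyhedron_imp finite;
        rule cle lec le0; intro lin)
  moreover have "?H = described_polytope E Q"
    unfolding described_polytope_def unit_box_def mccormick_def cycle_inequality_def eq0
    by (simp add: case_prod_unfold conj_assoc)
  moreover have "bounded (described_polytope E Q)"
  proof -
    have "bounded (cbox 0 (1 :: real ^ 'n) \<times> cbox 0 (1 :: real ^ 'n set))"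
      by (intro bounded_Times bounded_cbox)
    then show ?thesis
      by (rule bounded_subset)
        (force simp: described_polytope_def unit_box_def mem_box_cart)
  qed
  ultimately show ?thesis
    by (metis polytope_eq_bounded_polyhedron)
qed

lemma linear_proj_map: "linear (proj_map E a)"
  by (intro linearI) (auto simp: proj_map_def algebra_simps sum.distrib sum_distrib_left
      split: prod.splits)

subsection \<open>Cycle inequalities\<close>

text \<open>Indices are read modulo the length, so that sums around the walk can be shifted by
  one.\<close>

definition cyc_edge :: "'n list \<Rightarrow> nat \<Rightarrow> 'n set" where
  "cyc_edge vs i = {vs ! (i mod length vs), vs ! (Suc i mod length vs)}"

lemma closed_walk_edges_conv: "closed_walk_edges vs = cyc_edge vs ` {..<length vs}"
  by (auto simp: closed_walk_edges_def cyc_edge_def)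

lemma cyc_edge_mod: "cyc_edge vs (i mod length vs) = cyc_edge vs i"
  by (simp add: cyc_edge_def mod_Suc_eq)

lemma cyc_edge_mem: "vs \<noteq> [] \<Longrightarrow> cyc_edge vs i \<in> closed_walk_edges vs"
  by (metis closed_walk_edges_conv cyc_edge_mod imageI length_greater_0_conv lessThan_iff
      mod_less_divisor)

lemma sum_periodic_Suc:
  fixes h :: "nat \<Rightarrow> 'a::ab_group_add"
  assumes "h m = h 0"
  shows "(\<Sum>i<m. h (Suc i)) = (\<Sum>i<m. h i)"
  using sum.lessThan_Suc[of h m] sum.lessThan_Suc_shift[of h m] assms by (simp add: add.commute)

locale cycle_list =
  fixes vs :: "'n::finite list"
  assumes distinct: "distinct vs" and length_ge: "3 \<le> length vs"
begin

abbreviation "m \<equiv> length vs"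
abbreviation "vtx i \<equiv> vs ! (i mod m)"

lemma m_pos: "0 < m"
  using length_ge by linarith

lemma vtx_eq_iff: "vtx i = vtx j \<longleftrightarrow> i mod m = j mod m"
  using distinct m_pos by (simp add: nth_eq_iff_index_eq)

lemma mod_neq: "i mod m \<noteq> Suc i mod m" "i mod m \<noteq> Suc (Suc i) mod m"
  using length_ge by (auto simp: mod_Suc)

lemma Suc_mod_eq_iff: "Suc i mod m = Suc j mod m \<longleftrightarrow> i mod m = j mod m"
  using m_pos mod_less_divisor[of m i] mod_less_divisor[of m j] by (auto simp: mod_Suc)

text \<open>A match with the ends reversed would make \<open>i\<close> and \<open>i + 2\<close>
  agree modulo \<open>m\<close>, impossible for \<open>m\<close> at least 3.\<close>

lemma edge_eq_iff: "cyc_edge vs i = cyc_edge vs j \<longleftrightarrow> i mod m = j mod m"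
  using mod_neq(2)[of i] mod_neq(2)[of j] Suc_mod_eq_iff[of i j] Suc_mod_eq_iff[of "Suc i" j]
  by (auto simp: cyc_edge_def doubleton_eq_iff vtx_eq_iff)

lemma inj_edge: "inj_on (cyc_edge vs) {..<m}"
  by (auto simp: inj_on_def edge_eq_iff)

lemma sum_edges: "(\<Sum>e\<in>closed_walk_edges vs. g e) = (\<Sum>i<m. g (cyc_edge vs i))"
  by (simp add: closed_walk_edges_conv sum.reindex inj_edge)

lemma sum_edge: "(\<Sum>v\<in>cyc_edge vs i. x v) = x (vtx i) + (x (vtx (Suc i)) :: real)"
  using mod_neq(1)[of i] by (simp add: cyc_edge_def vtx_eq_iff)

lemma vtx_in_edge_iff: "vtx (Suc i) \<in> cyc_edge vs j \<longleftrightarrow> j mod m = i mod m \<or> j mod m = Suc i mod m"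
  by (auto simp: cyc_edge_def vtx_eq_iff Suc_mod_eq_iff)

text \<open>Only the cycle edges with indices \<open>i\<close> and \<open>Suc i\<close> contain this
  vertex. An edge meets itself in two vertices, so a one-point intersection must use both of
  them.\<close>

lemma meeting_vertices_iff:
  assumes "S \<subseteq> closed_walk_edges vs"
  shows "vtx (Suc i) \<in> meeting_vertices S \<longleftrightarrow> cyc_edge vs i \<in> S \<and> cyc_edge vs (Suc i) \<in> S"
    (is "?u \<in> _ \<longleftrightarrow> ?R")
proof
  assume "?u \<in> meeting_vertices S"
  then obtain e e' where e: "e \<in> S" "e' \<in> S" "e \<inter> e' = {?u}"
    by (auto simp: meeting_vertices_def)
  have *: "f = cyc_edge vs i \<or> f = cyc_edge vs (Suc i)" if f: "f \<in> S" "?u \<in> f" for f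
  proof -
    obtain j where "f = cyc_edge vs j"
      using f assms by (auto simp: closed_walk_edges_conv)
    then show ?thesis
      using f vtx_in_edge_iff edge_eq_iff by metis
  qed
  have "e \<noteq> e'"
  proof
    assume "e = e'"
    then have "\<exists>j. cyc_edge vs j = {?u}"
      using e * by fastforce
    then show False
      using mod_neq(1) by (metis cyc_edge_def doubleton_eq_iff insert_absorb2 vtx_eq_iff)
  qed
  then show ?R
    using e *[of e] *[of e'] by blast
next
  assume ?R
  moreover have "cyc_edge vs i \<inter> cyc_edge vs (Suc i) = {?u}"
    using mod_neq[of i] mod_neq(1)[of "Suc i"] by (auto simp: cyc_edge_def vtx_eq_iff)
  ultimately show "?u \<in> meeting_vertices S"
    by (auto simp: meeting_vertices_def)
qed

lemma sum_meeting_vertices: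
  fixes x :: "'n \<Rightarrow> real"
  assumes "S \<subseteq> closed_walk_edges vs"
  shows "(\<Sum>u\<in>meeting_vertices S. x u) =
    (\<Sum>i<m. of_bool (cyc_edge vs i \<in> S \<and> cyc_edge vs (Suc i) \<in> S) * x (vtx (Suc i)))"
proof -
  let ?v = "\<lambda>i. vtx (Suc i)"
  have inj: "inj_on ?v {..<m}"
    by (auto simp: inj_on_def vtx_eq_iff Suc_mod_eq_iff)
  have "?v ` {..<m} \<subseteq> set vs"
    using m_pos by auto
  moreover have "card (?v ` {..<m}) = card (set vs)"
    by (simp add: card_image inj distinct distinct_card)
  ultimately have img: "?v ` {..<m} = set vs"
    by (simp add: card_subset_eq)
  have sub: "meeting_vertices S \<subseteq> set vs"
  proof
    fix u
    assume "u \<in> meeting_vertices S"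
    then obtain e where "e \<in> S" "u \<in> e"
      by (auto simp: meeting_vertices_def)
    then show "u \<in> set vs"
      using assms m_pos by (auto simp: closed_walk_edges_conv cyc_edge_def)
  qed
  have "(\<Sum>u\<in>meeting_vertices S. x u) = (\<Sum>u\<in>set vs. of_bool (u \<in> meeting_vertices S) * x u)"
    by (rule sum.mono_neutral_cong_left) (use sub in auto)
  also have "\<dots> = (\<Sum>i<m. of_bool (?v i \<in> meeting_vertices S) * x (?v i))"
    unfolding img[symmetric] by (simp add: sum.reindex[OF inj])
  finally show ?thesis
    using meeting_vertices_iff[OF assms] by simp
qed

text \<open>Each vertex of the cycle lies on exactly two of its edges, so the vertex part of a cycle
  inequality can be distributed evenly over the edges.\<close>

lemma meeting_vertices_diff:
  fixes x :: "'n \<Rightarrow> real"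
  assumes D: "D \<subseteq> closed_walk_edges vs"
  shows "(\<Sum>u\<in>meeting_vertices D. x u) - (\<Sum>u\<in>meeting_vertices (closed_walk_edges vs - D). x u)
    = (\<Sum>e\<in>D. (\<Sum>v\<in>e. x v) / 2) - (\<Sum>e\<in>closed_walk_edges vs - D. (\<Sum>v\<in>e. x v) / 2)"
proof -
  let ?C = "closed_walk_edges vs"
  \<comment> \<open>\<open>p\<close> is 1/2 on \<open>D\<close> and -1/2 off it, so
    \<open>p i + p (Suc i)\<close> is 1 if both edges lie in \<open>D\<close>, -1 if neither does
    and 0 otherwise: the coefficient of their common vertex.\<close>
  define p :: "nat \<Rightarrow> real" where "p i = of_bool (cyc_edge vs i \<in> D) - 1/2" for i
  define X where "X i = x (vtx i)" for i
  have vs: "vs \<noteq> []"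
    using m_pos by auto
  have "(\<Sum>u\<in>meeting_vertices D. x u) - (\<Sum>u\<in>meeting_vertices (?C - D). x u)
      = (\<Sum>i<m. p (Suc i) * X (Suc i) + p i * X (Suc i))"
    unfolding sum_meeting_vertices[OF D] sum_meeting_vertices[OF Diff_subset] sum_subtractf[symmetric]
    using cyc_edge_mem[OF vs] by (intro sum.cong) (auto simp: p_def X_def)
  also have "\<dots> = (\<Sum>i<m. p i * X i) + (\<Sum>i<m. p i * X (Suc i))"
    by (subst sum.distrib, subst sum_periodic_Suc)
      (use cyc_edge_mod[of vs m] in \<open>auto simp: p_def X_def\<close>)
  also have "\<dots> = (\<Sum>i<m. 2 * p i * ((\<Sum>v\<in>cyc_edge vs i. x v) / 2))"
    unfolding sum.distrib[symmetric] by (simp add: sum_edge X_def distrib_left add_divide_distrib)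
  also have "\<dots> = (\<Sum>e\<in>?C. (if e \<in> D then (\<Sum>v\<in>e. x v) / 2 else - ((\<Sum>v\<in>e. x v) / 2)))"
    unfolding sum_edges by (intro sum.cong) (auto simp: p_def)
  also have "\<dots> = (\<Sum>e\<in>D. (\<Sum>v\<in>e. x v) / 2) - (\<Sum>e\<in>?C - D. (\<Sum>v\<in>e. x v) / 2)"
    using D by (simp add: sum.If_cases Int_absorb1 Diff_eq[symmetric] sum_negf)
  finally show ?thesis .
qed

end

text \<open>The tolerance of an edge: how far its two centres may deviate from being antipodal (in
  \<open>D\<close>) or from coinciding (off \<open>D\<close>).\<close>

definition slack :: "'n::finite set set \<Rightarrow> real ^ 'n \<Rightarrow> real ^ 'n set \<Rightarrow> 'n set \<Rightarrow> real" where
  "slack D x y e = (let g = (\<Sum>v\<in>e. x $ v) / 2 - y $ e in if e \<in> D then 1/2 - g else g)"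

lemma slack_Int: "e \<in> C \<Longrightarrow> slack (C \<inter> D) x y e = slack D x y e"
  by (simp add: slack_def)

text \<open>With \<open>g\<close> as in \<open>slack\<close>, \<open>meeting_vertices_diff\<close>
  turns the left side into the sum of \<open>g\<close> over \<open>D\<close> minus its sum over the
  other edges; moving \<open>card D / 2\<close> across gives the slacks.\<close>

lemma (in cycle_list) cycle_inequality_iff_slack:
  assumes D: "D \<subseteq> closed_walk_edges vs"
  shows "cycle_inequality (closed_walk_edges vs) D x y \<longleftrightarrow>
    1/2 \<le> (\<Sum>e\<in>closed_walk_edges vs. slack D x y e)"
proof -
  let ?C = "closed_walk_edges vs" and ?h = "\<lambda>e. (\<Sum>v\<in>e. x $ v) / 2"
  have "(\<Sum>e\<in>?C. slack D x y e) = (\<Sum>e\<in>D. slack D x y e) + (\<Sum>e\<in>?C - D. slack D x y e)"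
    by (simp add: sum.subset_diff[OF D] add.commute)
  also have "(\<Sum>e\<in>D. slack D x y e) = (\<Sum>e\<in>D. 1/2 - (?h e - y $ e))"
    by (simp add: slack_def)
  also have "(\<Sum>e\<in>?C - D. slack D x y e) = (\<Sum>e\<in>?C - D. ?h e - y $ e)"
    by (simp add: slack_def)
  finally show ?thesis
    using meeting_vertices_diff[OF D, of "\<lambda>i. x $ i"]
    unfolding cycle_inequality_def sum_subtractf sum_constant by (simp; linarith)
qed

section \<open>Validity of the cycle inequalities at product points\<close>

text \<open>Rearranged, this is the triangle inequality for \<open>1 - a * b\<close>. The terms with
  \<open>b\<close> are at most \<open>\<bar>a + c\<bar>\<close>, which is at most
  \<open>1 + a * c\<close>.\<close>

lemma sum_prod_le_one:
  fixes a b c :: real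
  assumes "\<bar>a\<bar> \<le> 1" "\<bar>b\<bar> \<le> 1" "\<bar>c\<bar> \<le> 1"
  shows "a * b + b * c - a * c \<le> 1"
proof -
  have "b * (a + c) \<le> \<bar>b\<bar> * \<bar>a + c\<bar>"
    unfolding abs_mult[symmetric] by (rule abs_ge_self)
  also have "\<dots> \<le> 1 * \<bar>a + c\<bar>"
    using assms(2) by (rule mult_right_mono) simp
  finally have "a * b + b * c \<le> \<bar>a + c\<bar>"
    by (simp add: algebra_simps)
  moreover have "0 \<le> (1 - a) * (1 - c)" "0 \<le> (1 + a) * (1 + c)"
    using assms by (intro mult_nonneg_nonneg; linarith)+
  then have "a + c \<le> 1 + a * c" "- (a + c) \<le> 1 + a * c"
    by (simp_all add: algebra_simps)
  ultimately show ?thesis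
    by linarith
qed

text \<open>For \<open>u i = 1 - 2 * x i\<close>, the quantity \<open>1 - u i * u j\<close> behaves like a metric on the vertices.\<close>

lemma signed_walk_triangle:
  fixes u s :: "nat \<Rightarrow> real"
  assumes u: "\<And>i. \<bar>u i\<bar> \<le> 1" and s: "\<And>i. \<bar>s i\<bar> = 1"
  shows "1 - (\<Prod>i<Suc n. s i) * u 0 * u (Suc n) \<le> (\<Sum>i<Suc n. 1 - s i * u i * u (Suc i))"
proof (induction n)
  case (Suc n)
  let ?P = "\<Prod>i<Suc n. s i"
  have "\<bar>?P\<bar> = 1"
    by (simp add: abs_prod s abs_mult)
  then have "\<bar>?P * u 0\<bar> \<le> 1" "\<bar>s (Suc n) * u (Suc (Suc n))\<bar> \<le> 1"
    using u s by (simp_all add: abs_mult)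
  \<comment> \<open>The signs are absorbed into the two end values, leaving the unsigned triangle
    inequality.\<close>
  then have "(?P * u 0) * u (Suc n) + u (Suc n) * (s (Suc n) * u (Suc (Suc n)))
      - (?P * u 0) * (s (Suc n) * u (Suc (Suc n))) \<le> 1"
    using u by (intro sum_prod_le_one)
  then show ?case
    using Suc by (simp add: algebra_simps)
qed simp

text \<open>The sign of the last edge is opposite to the product of the others. Hence its term is
  \<open>1 + r\<close> where the walk bound for the other edges is \<open>1 - r\<close>.\<close>

lemma signed_cycle_sum:
  fixes u s :: "nat \<Rightarrow> real"
  assumes u: "\<And>i. \<bar>u i\<bar> \<le> 1" and s: "\<And>i. \<bar>s i\<bar> = 1"
    and m: "2 \<le> m" and closed: "u m = u 0" and odd: "(\<Prod>i<m. s i) = -1"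
  shows "2 \<le> (\<Sum>i<m. 1 - s i * u i * u (Suc i))"
proof -
  obtain n where n: "m = Suc (Suc n)"
    using m by (metis add_2_eq_Suc le_Suc_ex)
  have "(\<Prod>i<Suc n. s i) * s (Suc n) = -1" "s (Suc n) = 1 \<or> s (Suc n) = -1"
    using odd n s[of "Suc n"] by (auto simp: abs_if split: if_splits)
  then have "s (Suc n) = - (\<Prod>i<Suc n. s i)"
    by auto
  moreover have "1 - (\<Prod>i<Suc n. s i) * u 0 * u (Suc n) \<le> (\<Sum>i<Suc n. 1 - s i * u i * u (Suc i))"
    by (intro signed_walk_triangle u s)
  ultimately show ?thesis
    using closed by (simp add: n algebra_simps)
qed

text \<open>At a product point four times the slack is \<open>1 - s i * u i * u (Suc i)\<close>.
  Since \<open>card D\<close> is odd, the signs multiply to -1 and the bound 2 becomes the required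
  1/2.\<close>

lemma (in cycle_list) cycle_inequality_prod:
  assumes D: "D \<subseteq> closed_walk_edges vs" "odd (card D)"
    and x: "\<And>i. 0 \<le> x $ i \<and> x $ i \<le> 1"
    and y: "\<And>e. e \<in> closed_walk_edges vs \<Longrightarrow> y $ e = (\<Prod>i\<in>e. x $ i)"
  shows "cycle_inequality (closed_walk_edges vs) D x y"
proof -
  let ?C = "closed_walk_edges vs"
  define u where "u i = 1 - 2 * x $ vtx i" for i
  define s :: "nat \<Rightarrow> real" where "s i = (if cyc_edge vs i \<in> D then -1 else 1)" for i
  have "(\<Prod>i<m. s i) = (\<Prod>e\<in>?C. if e \<in> D then -1 else 1)"
    by (simp add: s_def closed_walk_edges_conv prod.reindex inj_edge)
  also have "\<dots> = (-1) ^ card D"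
    using D(1) by (simp add: prod.If_cases Int_absorb1)
  finally have odd: "(\<Prod>i<m. s i) = -1"
    using D(2) by simp
  have "\<bar>u i\<bar> \<le> 1" for i
    using x[of "vtx i"] by (auto simp: u_def abs_le_iff)
  then have "2 \<le> (\<Sum>i<m. 1 - s i * u i * u (Suc i))"
    using length_ge odd by (intro signed_cycle_sum) (auto simp: s_def u_def)
  also have "\<dots> = (\<Sum>i<m. 4 * slack D x y (cyc_edge vs i))"
  proof (intro sum.cong refl)
    fix i
    have ne: "vtx i \<noteq> vtx (Suc i)" and mem: "cyc_edge vs i \<in> ?C"
      using mod_neq(1)[of i] m_pos by (auto simp: vtx_eq_iff intro!: cyc_edge_mem)
    have "y $ cyc_edge vs i = x $ vtx i * x $ vtx (Suc i)"
      unfolding y[OF mem] using ne by (simp add: cyc_edge_def)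
    then show "1 - s i * u i * u (Suc i) = 4 * slack D x y (cyc_edge vs i)"
      using sum_edge[of "\<lambda>v. x $ v" i] by (simp add: slack_def s_def u_def algebra_simps)
  qed
  finally show ?thesis
    using cycle_inequality_iff_slack[OF D(1)] by (simp add: sum_edges sum_distrib_left[symmetric])
qed

subsection \<open>Blocks of a cactus\<close>

lemma closed_walk_edges_subset_iff:
  assumes "ws \<noteq> []"
  shows "closed_walk_edges ws \<subseteq> E \<longleftrightarrow>
    successively (\<lambda>a b. {a, b} \<in> E) ws \<and> {last ws, hd ws} \<in> E"
proof -
  let ?n = "length ws"
  have split: "{..<?n} = insert (?n - 1) {i. Suc i < ?n}"
    using assms by (auto simp: neq_Nil_conv)
  have "cyc_edge ws (?n - 1) = {last ws, hd ws}"
    using assms by (simp add: cyc_edge_def last_conv_nth hd_conv_nth)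
  moreover have "cyc_edge ws i = {ws ! i, ws ! Suc i}" if "Suc i < ?n" for i
    using that by (simp add: cyc_edge_def)
  ultimately show ?thesis
    unfolding closed_walk_edges_conv split successively_conv_nth by auto
qed

lemma walk_if_rtrancl:
  assumes "(a, b) \<in> {(a, b). {a, b} \<in> F}\<^sup>*"
  shows "\<exists>p. p \<noteq> [] \<and> hd p = a \<and> last p = b \<and> successively (\<lambda>a b. {a, b} \<in> F) p"
  using assms
proof (induction rule: rtrancl_induct)
  case base
  then show ?case
    by (intro exI[of _ "[a]"]) auto
next
  case (step b c)
  then obtain p where "p \<noteq> []" "hd p = a" "last p = b" "successively (\<lambda>a b. {a, b} \<in> F) p"
    by auto
  then show ?case
    using step by (intro exI[of _ "p @ [c]"]) (auto simp: successively_append_iff)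
qed

lemma successively_edge_rev:
  "successively (\<lambda>a b. {a, b} \<in> F) (rev p) \<longleftrightarrow> successively (\<lambda>a b. {a, b} \<in> F) p"
  by (simp add: successively_rev insert_commute)

text \<open>A block is a whole cycle, or an edge \<open>{u, v}\<close> that lies on no cycle; the latter is encoded as the
  degenerate closed walk \<open>[u, v]\<close>.\<close>

locale block =
  fixes E :: "'n::finite set set" and vs :: "'n list"
  assumes distinct: "distinct vs" and length_ge: "2 \<le> length vs"
    and sub: "closed_walk_edges vs \<subseteq> E"
    and cycle_eq: "\<And>C. C \<in> cycles E \<Longrightarrow> C \<inter> closed_walk_edges vs \<noteq> {} \<Longrightarrow> C = closed_walk_edges vs"
begin

abbreviation "B \<equiv> closed_walk_edges vs"
abbreviation "walk \<equiv> successively (\<lambda>a b. {a, b} \<in> E - B)"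

text \<open>The ear and the arc of the block between its ends would form a cycle having an edge in
  \<open>B\<close> and an edge outside it, against \<open>cycle_eq\<close>.\<close>

lemma no_ear:
  assumes vs: "vs = xs @ u # ns @ w # zs"
    and walk: "walk (u # ms @ [w])" and dist: "distinct (u # ms @ [w])" "set ms \<inter> set vs = {}"
  shows False
proof -
  \<comment> \<open>Along the block from \<open>u\<close> to \<open>w\<close>, then back along the
    ear.\<close>
  define ws where "ws = u # ns @ w # rev ms"
  have "successively (\<lambda>a b. {a, b} \<in> B) vs"
    using closed_walk_edges_subset_iff[of vs B] vs by simp
  then have "successively (\<lambda>a b. {a, b} \<in> B) (xs @ (u # ns @ [w]) @ zs)"
    using vs by simp
  then have arc: "successively (\<lambda>a b. {a, b} \<in> B) (u # ns @ [w])"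
    unfolding successively_append_iff by blast
  have first: "{u, hd (ns @ [w])} \<in> B"
    using arc by (cases ns) auto
  have ear: "{u, hd (ms @ [w])} \<in> E - B"
    using walk by (cases ms) auto
  have "walk (rev (ms @ [w]))"
    unfolding successively_edge_rev using walk by (simp add: successively_Cons)
  then have "walk (w # rev ms)"
    by simp
  then have "successively (\<lambda>a b. {a, b} \<in> E) (w # rev ms)"
    by (rule successively_mono) auto
  moreover have "successively (\<lambda>a b. {a, b} \<in> E) (u # ns @ [w])"
    using arc sub by (elim successively_mono) auto
  ultimately have "successively (\<lambda>a b. {a, b} \<in> E) ((u # ns) @ w # rev ms)"
    using successively_append_iff[of _ "u # ns" "[w]"] successively_append_iff[of _ "u # ns" "w # rev ms"]
    by simp
  then have "successively (\<lambda>a b. {a, b} \<in> E) ws"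
    by (simp add: ws_def)
  moreover have last: "{last ws, hd ws} = {u, hd (ms @ [w])}"
    by (cases ms) (auto simp: ws_def)
  ultimately have "closed_walk_edges ws \<subseteq> E"
    using ear by (subst closed_walk_edges_subset_iff) (auto simp: ws_def)
  moreover have "distinct ws"
    using distinct dist by (auto simp: ws_def vs)
  \<comment> \<open>If \<open>ns\<close> and \<open>ms\<close> were both empty,
    \<open>{u, w}\<close> would lie in \<open>B\<close> and outside it.\<close>
  moreover have "3 \<le> length ws"
    using first ear by (cases ns; cases ms) (auto simp: ws_def)
  ultimately have "closed_walk_edges ws \<in> cycles E"
    by (auto simp: cycles_def)
  moreover have ws_edges: "successively (\<lambda>a b. {a, b} \<in> closed_walk_edges ws) ws"
      "{last ws, hd ws} \<in> closed_walk_edges ws"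
    using closed_walk_edges_subset_iff[of ws "closed_walk_edges ws"] by (simp_all add: ws_def)
  have "{u, hd (ns @ [w])} \<in> closed_walk_edges ws"
    using ws_edges(1) by (cases ns) (auto simp: ws_def)
  then have "closed_walk_edges ws \<inter> B \<noteq> {}"
    using first by blast
  ultimately have "closed_walk_edges ws = B"
    by (intro cycle_eq)
  then show False
    using ws_edges(2) last ear by simp
qed

text \<open>A shortest walk outside \<open>B\<close> between two different block vertices is an
  ear.\<close>

lemma disconnected:
  assumes ab: "a \<in> set vs" "b \<in> set vs" "(a, b) \<in> {(a, b). {a, b} \<in> E - B}\<^sup>*"
  shows "a = b"
proof (rule ccontr)
  assume "a \<noteq> b"
  define W where "W p \<longleftrightarrow> p \<noteq> [] \<and> walk p \<and> hd p \<in> set vs \<and> last p \<in> set vs \<and> hd p \<noteq> last p" for p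
  obtain p0 where "W p0"
    using walk_if_rtrancl[OF ab(3)] ab \<open>a \<noteq> b\<close> unfolding W_def by metis
  then obtain p where p: "W p" and min: "\<And>q. W q \<Longrightarrow> length p \<le> length q"
    using ex_has_least_nat[of W p0 length] by blast
  obtain u ms w where p_eq: "p = u # ms @ [w]"
  proof -
    obtain u q where "p = u # q"
      using p by (cases p) (auto simp: W_def)
    moreover have "q \<noteq> []"
      using p calculation by (auto simp: W_def)
    then obtain ms w where "q = ms @ [w]"
      by (metis rev_exhaust)
    ultimately show ?thesis
      using that by blast
  qed
  \<comment> \<open>Otherwise the loop between two occurrences of a vertex could be cut out, keeping
    both ends.\<close>
  have dist: "distinct p"
  proof (rule ccontr)
    assume "\<not> distinct p"
    then obtain xs ys zs c where c: "p = xs @ [c] @ ys @ [c] @ zs"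
      using not_distinct_decomp by blast
    then have "walk (xs @ [c] @ zs)"
      using p unfolding W_def c by (auto simp: successively_append_iff successively_Cons)
    moreover have "hd (xs @ [c] @ zs) = hd p" "last (xs @ [c] @ zs) = last p"
      unfolding c by (simp_all add: hd_append)
    ultimately have "W (xs @ [c] @ zs)"
      using p by (simp add: W_def)
    then show False
      using min c by fastforce
  qed
  \<comment> \<open>Stopping at an inner block vertex would give a shorter walk, whose ends differ
    because \<open>p\<close> is distinct.\<close>
  have inner: "set ms \<inter> set vs = {}"
  proof (rule ccontr)
    assume "set ms \<inter> set vs \<noteq> {}"
    then obtain c ms1 ms2 where c: "c \<in> set vs" "ms = ms1 @ c # ms2"
      by (metis disjoint_iff split_list)
    then have "walk ((u # ms1 @ [c]) @ ms2 @ [w])"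
      using p by (simp add: W_def p_eq)
    then have "walk (u # ms1 @ [c])"
      unfolding successively_append_iff[of _ "u # ms1 @ [c]"] by blast
    then have "W (u # ms1 @ [c])"
      using p dist c by (auto simp: W_def p_eq)
    then show False
      using min c p_eq by fastforce
  qed
  have walk: "walk (u # ms @ [w])" and uw: "u \<in> set vs" "w \<in> set vs" "u \<noteq> w"
    using p by (auto simp: W_def p_eq)
  obtain xs ys where vs: "vs = xs @ u # ys"
    using uw split_list by metis
  show False
  proof (cases "w \<in> set ys")
    case True
    then obtain ns zs where "ys = ns @ w # zs"
      using split_list by metis
    then show False
      using no_ear[of xs u ns w zs ms] vs walk dist inner p_eq by simp
  next
    \<comment> \<open>Here \<open>w\<close> precedes \<open>u\<close> in \<open>vs\<close>, so the
      ear is traversed backwards.\<close>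
    case False
    then obtain ns zs where "xs = ns @ w # zs"
      using uw vs split_list[of w xs] by auto
    moreover have "walk (w # rev ms @ [u])"
      using walk successively_edge_rev[of "E - B" "u # ms @ [w]"] by simp
    ultimately show False
      using no_ear[of ns w zs u ys "rev ms"] vs dist inner p_eq by auto
  qed
qed

end

text \<open>Starting from any edge, a cycle through it serves, since in a cactus every cycle sharing
  an edge with it equals it; if there is none, the edge alone serves.\<close>

lemma cactus_obtain_block:
  assumes "cactus E" "E \<noteq> {}"
  obtains vs where "block E vs"
proof -
  obtain e where e: "e \<in> E"
    using assms by auto
  show ?thesis
  proof (cases "\<exists>C\<in>cycles E. e \<in> C")
    case True
    then obtain C where C: "C \<in> cycles E"
      by auto
    then obtain vs where vs: "distinct vs" "3 \<le> length vs" "C = closed_walk_edges vs" "C \<subseteq> E"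
      by (auto simp: cycles_def)
    have "C' = C" if C': "C' \<in> cycles E" "C' \<inter> C \<noteq> {}" for C'
    proof -
      obtain e' where "e' \<in> C" "e' \<in> C'" "e' \<in> E"
        using C'(2) vs(4) by blast
      then show ?thesis
        using assms(1) C C'(1) unfolding cactus_def by blast
    qed
    then have "block E vs"
      using vs by (simp add: block_def)
    then show ?thesis
      by (rule that)
  next
    case False
    obtain u v where uv: "e = {u, v}" "u \<noteq> v"
      using assms e by (metis cactus_def simple_graph_def card_2_iff)
    have "{..<length [u, v]} = {0, 1}"
      by auto
    then have "closed_walk_edges [u, v] = {e}"
      by (simp add: closed_walk_edges_conv cyc_edge_def uv insert_commute)
    then have "block E [u, v]"
      using uv e False by (auto simp: block_def)
    then show ?thesis
      by (rule that)
  qed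
qed

lemma cycles_mono: "F \<subseteq> E \<Longrightarrow> cycles F \<subseteq> cycles E"
  by (auto simp: cycles_def)

lemma cactus_subset: "cactus E \<Longrightarrow> F \<subseteq> E \<Longrightarrow> cactus F"
  using cycles_mono[of F E] unfolding cactus_def simple_graph_def by blast

subsection \<open>Placing the vertices on a circle\<close>

text \<open>Step \<open>i\<close> turns by \<open>\<tau> i\<close> plus a common fraction
  \<open>c\<close> of its tolerance, and the walk closes if the total turn is an integer. The
  \<open>\<tau> i\<close> add up to a multiple of 1/2, so at most an extra 1/2 has to be
  gained.\<close>

lemma cyclic_placement:
  fixes \<tau> \<sigma> :: "nat \<Rightarrow> real"
  assumes \<sigma>: "\<And>i. 0 \<le> \<sigma> i" and \<tau>: "\<And>i. \<tau> i = 0 \<or> \<tau> i = 1/2"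
    and closes: "(\<Sum>i<m. \<tau> i) \<in> \<int> \<or> 1/2 \<le> (\<Sum>i<m. \<sigma> i)"
  obtains t :: "nat \<Rightarrow> real"
  where "\<And>i. i < m \<Longrightarrow> \<exists>k::int. \<bar>t (Suc i mod m) - t i - k - \<tau> i\<bar> \<le> \<sigma> i"
proof -
  let ?T = "\<Sum>i<m. \<tau> i" and ?S = "\<Sum>i<m. \<sigma> i"
  have half: "?T \<in> \<int> \<or> ?T + 1/2 \<in> \<int>"
  proof (induction m)
    case (Suc m)
    from Suc obtain z :: int where "(\<Sum>i<m. \<tau> i) = z \<or> (\<Sum>i<m. \<tau> i) + 1/2 = z"
      by (auto elim!: Ints_cases)
    then have "(\<Sum>i<Suc m. \<tau> i) = z \<or> (\<Sum>i<Suc m. \<tau> i) + 1/2 = of_int (z + 1)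
        \<or> (\<Sum>i<Suc m. \<tau> i) + 1/2 = z"
      using \<tau>[of m] by auto
    then show ?case
      by (metis Ints_of_int)
  qed simp
  obtain c where c: "0 \<le> c" "c \<le> 1" "?T + c * ?S \<in> \<int>"
  proof (cases "?T \<in> \<int>")
    case True
    then show ?thesis
      using that[of 0] by simp
  next
    case False
    then have "?T + 1/2 \<in> \<int>" "1/2 \<le> ?S"
      using half closes by auto
    then show ?thesis
      \<comment> \<open>This \<open>c\<close> adds exactly 1/2 to the total; it is at most 1 because
        \<open>1/2 \<le> ?S\<close>.\<close>
      by (intro that[of "1 / (2 * ?S)"]) (auto simp: field_simps)
  qed
  then obtain K :: int where K: "?T + c * ?S = K"
    by (auto elim: Ints_cases)
  define t where "t i = (\<Sum>j<i. \<tau> j + c * \<sigma> j)" for i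
  have step: "t (Suc i) - t i - \<tau> i = c * \<sigma> i" for i
    by (simp add: t_def)
  have le: "\<bar>c * \<sigma> i\<bar> \<le> \<sigma> i" for i
    using c \<sigma>[of i] by (simp add: abs_mult mult_left_le_one_le)
  have tm: "t m = K"
    using K by (simp add: t_def sum.distrib sum_distrib_left)
  show ?thesis
  proof (rule that)
    fix i
    assume i: "i < m"
    show "\<exists>k::int. \<bar>t (Suc i mod m) - t i - k - \<tau> i\<bar> \<le> \<sigma> i"
    proof (cases "Suc i < m")
      case True
      then show ?thesis
        using step[of i] le[of i] by (intro exI[of _ 0]) simp
    next
      case False
      then have "Suc i = m"
        using i by simp
      moreover have "t 0 = 0"
        by (simp add: t_def)
      \<comment> \<open>The step leads to \<open>t m = K\<close> but is compared with
        \<open>t 0 = 0\<close>; the integer \<open>- K\<close> makes up the difference.\<close>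
      ultimately show ?thesis
        using step[of i] le[of i] tm by (intro exI[of _ "- K"]) auto
    qed
  qed
qed

text \<open>\<open>\<theta>\<close> gives real representatives of points on a circle of
  circumference 1; \<open>k\<close> makes the distances circular.\<close>

definition placed :: "'n set set \<Rightarrow> 'n set set \<Rightarrow> ('n set \<Rightarrow> real) \<Rightarrow> ('n \<Rightarrow> real) \<Rightarrow> bool" where
  "placed E D s \<theta> \<longleftrightarrow> (\<forall>i j. {i, j} \<in> E \<longrightarrow>
     (\<exists>k::int. \<bar>\<theta> j - \<theta> i - k - (if {i, j} \<in> D then 1/2 else 0)\<bar> \<le> s {i, j}))"

text \<open>Antipodality is symmetric modulo 1, so the orientation of an edge is irrelevant.\<close>

lemma placed_sym:
  fixes a b s :: real and k :: int
  assumes "\<bar>b - a - k - (if P then 1/2 else 0)\<bar> \<le> s"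
  shows "\<exists>k::int. \<bar>a - b - k - (if P then 1/2 else 0)\<bar> \<le> s"
  \<comment> \<open>The extra -1 for an antipodal pair turns -1/2 into 1/2.\<close>
  using assms by (cases P; intro exI[of _ "if P then - k - 1 else - k"]; simp add: abs_le_iff)

text \<open>By \<open>disconnected\<close>, no component of \<open>E - B\<close> contains two block
  vertices, so values prescribed on the block extend to a function constant on components.\<close>

lemma (in block) exists_shift:
  fixes h :: "'n \<Rightarrow> real"
  obtains \<delta> where "\<And>a b. {a, b} \<in> E - B \<Longrightarrow> \<delta> a = \<delta> b" "\<And>v. v \<in> set vs \<Longrightarrow> \<delta> v = h v"
proof -
  define R where "R = {(a, b). {a, b} \<in> E - B}\<^sup>*"
  \<comment> \<open>In a component without block vertices the choice is arbitrary, yet the same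
    throughout, because the vertices of a component are reachable from the same vertices.\<close>
  define \<delta> where "\<delta> u = h (SOME v. v \<in> set vs \<and> (v, u) \<in> R)" for u
  show ?thesis
  proof (rule that)
    fix a b
    assume "{a, b} \<in> E - B"
    then have "(a, b) \<in> R" "(b, a) \<in> R"
      by (auto simp: R_def insert_commute)
    then have "(v, a) \<in> R \<longleftrightarrow> (v, b) \<in> R" for v
      unfolding R_def by (meson rtrancl_trans)
    then show "\<delta> a = \<delta> b"
      by (simp add: \<delta>_def)
  next
    fix v
    assume v: "v \<in> set vs"
    then have "(SOME u. u \<in> set vs \<and> (u, v) \<in> R) = v"
      using disconnected by (intro some_equality) (auto simp: R_def)
    then show "\<delta> v = h v"
      by (simp add: \<delta>_def)
  qed
qed

text \<open>A walk of length 2 passes its edge twice, so the twists add up to 0 or 1. On a cycle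
  they add up to half of \<open>card (B \<inter> D)\<close>, which is an integer unless that number
  is odd.\<close>

lemma (in block) sum_twists:
  fixes s :: "'n set \<Rightarrow> real"
  assumes "odd (card (B \<inter> D)) \<Longrightarrow> B \<in> cycles E \<Longrightarrow> 1/2 \<le> (\<Sum>e\<in>B. s e)"
  shows "(\<Sum>i<length vs. if cyc_edge vs i \<in> D then 1/2 else 0 :: real) \<in> \<int>
    \<or> 1/2 \<le> (\<Sum>i<length vs. s (cyc_edge vs i))"
proof (cases "length vs = 2")
  case True
  then have "cyc_edge vs 1 = cyc_edge vs 0"
    by (auto simp: cyc_edge_def)
  then show ?thesis
    using True by (auto simp: numeral_2_eq_2 lessThan_Suc)
next
  case False
  then interpret cycle_list vs
    using distinct length_ge by unfold_locales auto
  have B: "B \<in> cycles E"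
    using sub distinct cycle_list.length_ge[OF cycle_list_axioms] by (auto simp: cycles_def)
  have "(\<Sum>i<length vs. if cyc_edge vs i \<in> D then 1/2 else 0 :: real)
      = (\<Sum>e\<in>B. if e \<in> D then 1/2 else 0)"
    by (simp add: sum_edges)
  also have "\<dots> = real (card (B \<inter> D)) / 2"
    by (simp add: sum.If_cases)
  finally have T: "(\<Sum>i<length vs. if cyc_edge vs i \<in> D then 1/2 else 0 :: real)
      = real (card (B \<inter> D)) / 2" .
  show ?thesis
  proof (cases "odd (card (B \<inter> D))")
    case True
    then show ?thesis
      using assms B by (simp add: sum_edges)
  next
    case False
    then show ?thesis
      unfolding T by (auto elim!: evenE)
  qed
qed

lemma exists_placed:
  fixes E :: "'n::finite set set" and s :: "'n set \<Rightarrow> real"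
  assumes "cactus E"
    and "\<And>e. e \<in> E \<Longrightarrow> 0 \<le> s e"
    and "\<And>C. C \<in> cycles E \<Longrightarrow> odd (card (C \<inter> D)) \<Longrightarrow> 1/2 \<le> (\<Sum>e\<in>C. s e)"
  shows "\<exists>\<theta>. placed E D s \<theta>"
  using finite[of E] assms
proof (induction E rule: finite_psubset_induct)
  case (psubset E)
  show ?case
  proof (cases "E = {}")
    case True
    then show ?thesis
      by (simp add: placed_def)
  next
    case False
    then obtain vs where "block E vs"
      using cactus_obtain_block psubset.prems(1) by blast
    then interpret block E vs .
    have ne: "vs \<noteq> []"
      using length_ge by auto
    have "E - B \<subset> E"
      using sub cyc_edge_mem[OF ne, of 0] by blast
    then obtain \<theta> where \<theta>: "placed (E - B) D s \<theta>"
      using psubset.IH[of "E - B"] psubset.prems cycles_mono[of "E - B" E]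
        cactus_subset[of E "E - B"] by (metis DiffD1 psubset_imp_subset subsetD)
    let ?\<tau> = "\<lambda>i. if cyc_edge vs i \<in> D then 1/2 else 0 :: real"
    obtain t :: "nat \<Rightarrow> real" where
      t: "\<exists>k::int. \<bar>t (Suc i mod length vs) - t i - k - ?\<tau> i\<bar> \<le> s (cyc_edge vs i)"
      if "i < length vs" for i
    proof (rule cyclic_placement)
      show "0 \<le> s (cyc_edge vs i)" for i
        using psubset.prems(2) sub cyc_edge_mem[OF ne] by blast
      show "(\<Sum>i<length vs. ?\<tau> i) \<in> \<int> \<or> 1/2 \<le> (\<Sum>i<length vs. s (cyc_edge vs i))"
        using psubset.prems(3) by (intro sum_twists)
    qed auto
    define tv where "tv v = t (the_inv_into {..<length vs} ((!) vs) v)" for v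
    have tv: "tv (vs ! i) = t i" if "i < length vs" for i
      using that distinct by (simp add: tv_def the_inv_into_f_f inj_on_nth)
    \<comment> \<open>The shift carries each block vertex to its position in \<open>t\<close>; being
      constant along the edges of \<open>E - B\<close>, it preserves their constraints.\<close>
    obtain \<delta> where \<delta>: "\<And>a b. {a, b} \<in> E - B \<Longrightarrow> \<delta> a = \<delta> b"
        "\<And>v. v \<in> set vs \<Longrightarrow> \<delta> v = tv v - \<theta> v"
      using exists_shift[of "\<lambda>v. tv v - \<theta> v"] by blast
    have "placed E D s (\<lambda>v. \<theta> v + \<delta> v)"
      unfolding placed_def
    proof (intro allI impI)
      fix a b
      assume ab: "{a, b} \<in> E"
      show "\<exists>k::int. \<bar>(\<theta> b + \<delta> b) - (\<theta> a + \<delta> a) - k - (if {a, b} \<in> D then 1/2 else 0)\<bar> \<le> s {a, b}"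
      proof (cases "{a, b} \<in> B")
        case False
        then show ?thesis
          using ab \<theta> \<delta>(1)[of a b] by (simp add: placed_def)
      next
        case True
        then obtain i where i: "i < length vs" "{a, b} = cyc_edge vs i"
          by (auto simp: closed_walk_edges_conv)
        let ?u = "vs ! i" and ?w = "vs ! (Suc i mod length vs)"
        have "\<theta> ?u + \<delta> ?u = t i" "\<theta> ?w + \<delta> ?w = t (Suc i mod length vs)"
          using i(1) ne by (simp_all add: \<delta>(2) tv)
        then obtain k :: int where k:
          "\<bar>(\<theta> ?w + \<delta> ?w) - (\<theta> ?u + \<delta> ?u) - k - (if {a, b} \<in> D then 1/2 else 0)\<bar> \<le> s {a, b}"
          using t[OF i(1)] i(2) by auto
        moreover have "a = ?u \<and> b = ?w \<or> a = ?w \<and> b = ?u"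
          using i by (auto simp: cyc_edge_def doubleton_eq_iff)
        ultimately show ?thesis
          using placed_sym[OF k] by blast
      qed
    qed
    then show ?thesis
      by blast
  qed
qed

subsection \<open>Random vertices\<close>

definition vertex_point :: "'n::finite set \<Rightarrow> real ^ 'n" where
  "vertex_point A = (\<chi> i. of_bool (i \<in> A))"

lemma quad_fun_vertex_point:
  "quad_fun E a (vertex_point A) = (\<Sum>e\<in>E. a e * of_bool (e \<subseteq> A))"
proof -
  have "(\<Prod>i\<in>e. vertex_point A $ i) = of_bool (e \<subseteq> A)" for e
    by (auto simp: vertex_point_def subset_iff)
  then show ?thesis
    by (simp add: quad_fun_def)
qed

text \<open>The events that the random set equals \<open>A\<close> partition the space. Their
  probabilities are the weights of a convex combination of graph points at vertices of the cube,
  whose coordinates are the marginal and joint probabilities.\<close>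

lemma random_set_in_hull_graph:
  fixes S :: "'n::finite \<Rightarrow> 'b set"
  assumes "prob_space M" and S: "\<And>i. S i \<in> sets M"
  shows "(\<chi> i. measure M (S i), \<Sum>e\<in>E. a e * measure M {\<omega> \<in> space M. \<forall>i\<in>e. \<omega> \<in> S i})
    \<in> hull_graph (quad_fun E a)"
proof -
  interpret prob_space M by fact
  define F where "F A = {\<omega> \<in> space M. {i. \<omega> \<in> S i} = A}" for A
  have F_sets [measurable]: "F A \<in> sets M" for A
  proof -
    have "F A = {\<omega> \<in> space M. \<forall>i. \<omega> \<in> S i \<longleftrightarrow> i \<in> A}"
      by (auto simp: F_def)
    also have "\<dots> \<in> sets M"
      using S by measurable
    finally show ?thesis .
  qed
  have prob_eq: "measure M {\<omega> \<in> space M. P {i. \<omega> \<in> S i}} = (\<Sum>A\<in>UNIV. measure M (F A) * of_bool (P A))"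
    for P
  proof -
    have "{\<omega> \<in> space M. P {i. \<omega> \<in> S i}} = (\<Union>A\<in>{A. P A}. F A)"
      by (auto simp: F_def)
    also have "measure M \<dots> = (\<Sum>A\<in>{A. P A}. measure M (F A))"
      by (intro finite_measure_finite_Union) (auto simp: disjoint_family_on_def F_def[abs_def] F_sets[unfolded F_def])
    also have "\<dots> = (\<Sum>A\<in>UNIV. measure M (F A) * of_bool (P A))"
      by (rule sum.mono_neutral_cong_left) auto
    finally show ?thesis .
  qed
  let ?z = "\<lambda>A. (vertex_point A, quad_fun E a (vertex_point A))"
  have "?z A \<in> hull_graph (quad_fun E a)" for A
    unfolding hull_graph_def by (intro hull_inc) (auto simp: vertex_point_def)
  moreover have "(\<Sum>A\<in>UNIV. measure M (F A)) = 1"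
    using prob_eq[of "\<lambda>_. True"] prob_space by simp
  ultimately have "(\<Sum>A\<in>UNIV. measure M (F A) *\<^sub>R ?z A) \<in> hull_graph (quad_fun E a)"
    by (intro convex_sum) (auto simp: hull_graph_def)
  moreover have "(\<Sum>A\<in>UNIV. measure M (F A) *\<^sub>R vertex_point A) = (\<chi> i. measure M (S i))"
  proof -
    have "S i = {\<omega> \<in> space M. i \<in> {i. \<omega> \<in> S i}}" for i
      using sets.sets_into_space[OF S] by auto
    then have "measure M (S i) = (\<Sum>A\<in>UNIV. measure M (F A) * of_bool (i \<in> A))" for i
      using prob_eq[of "\<lambda>A. i \<in> A"] by simp
    then show ?thesis
      by (simp add: vec_eq_iff vertex_point_def)
  qed
  moreover have "(\<Sum>A\<in>UNIV. measure M (F A) * quad_fun E a (vertex_point A))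
      = (\<Sum>e\<in>E. a e * measure M {\<omega> \<in> space M. \<forall>i\<in>e. \<omega> \<in> S i})"
  proof -
    have *: "measure M {\<omega> \<in> space M. \<forall>i\<in>e. \<omega> \<in> S i}
        = (\<Sum>A\<in>UNIV. measure M (F A) * of_bool (e \<subseteq> A))" for e
      using prob_eq[of "\<lambda>A. e \<subseteq> A"] by (simp add: subset_iff Ball_def)
    have "(\<Sum>A\<in>UNIV. measure M (F A) * quad_fun E a (vertex_point A))
        = (\<Sum>A\<in>UNIV. \<Sum>e\<in>E. a e * (measure M (F A) * of_bool (e \<subseteq> A)))"
      by (simp only: quad_fun_vertex_point sum_distrib_left mult.left_commute)
    also have "\<dots> = (\<Sum>e\<in>E. \<Sum>A\<in>UNIV. a e * (measure M (F A) * of_bool (e \<subseteq> A)))"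
      by (rule sum.swap)
    finally show ?thesis
      by (simp only: sum_distrib_left[symmetric] *)
  qed
  ultimately show ?thesis
    by (simp add: sum_prod scaleR_Pair)
qed

section \<open>Arcs on a circle of circumference 1\<close>

text \<open>The circle is \<open>{0..<1}\<close>, and \<open>frac\<close> measures how far
  \<open>u\<close> lies beyond the starting point of the arc. Arcs are half-open, so width 0 gives
  the empty set and width 1 the whole circle.\<close>

definition circ_arc :: "real \<Rightarrow> real \<Rightarrow> real set" where
  "circ_arc c w = {u \<in> {0..<1}. frac (u - (c - w / 2)) < w}"

text \<open>Cutting the circle at 0 leaves the arc in one piece unless it runs past 1; the overflow
  then reappears at 0.\<close>

lemma circ_arc_altdef:
  fixes c w :: real
  assumes "0 \<le> w" "w \<le> 1"
  defines "r \<equiv> frac (c - w / 2)"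
  shows "circ_arc c w = {r..<min 1 (r + w)} \<union> {0..<r + w - 1}"
proof -
  have r: "0 \<le> r" "r < 1"
    by (auto simp: r_def frac_lt_1)
  have "frac (u - (c - w / 2)) = (if r \<le> u then u - r else u - r + 1)" if "0 \<le> u" "u < 1" for u
  proof -
    have "u - (c - w / 2) = (u - r) - of_int \<lfloor>c - w / 2\<rfloor>"
      by (simp add: r_def frac_def)
    then have "frac (u - (c - w / 2)) = frac (u - r)"
      by (metis frac_1_eq frac_add_of_int_right add_uminus_conv_diff of_int_minus)
    also have "\<dots> = (if r \<le> u then u - r else u - r + 1)"
      using that r by (auto simp: frac_unique_iff)
    finally show ?thesis .
  qed
  then have "u \<in> circ_arc c w \<longleftrightarrow> 0 \<le> u \<and> u < 1 \<and> (if r \<le> u then u - r else u - r + 1) < w" for u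
    by (auto simp: circ_arc_def)
  then show ?thesis
    using assms(1,2) r by (intro set_eqI) (simp split: if_split; linarith)
qed

lemma circ_arc_subset_unit: "circ_arc c w \<subseteq> {0..<1}"
  by (auto simp: circ_arc_def)

lemma circ_arc_borel [measurable]: "circ_arc c w \<in> sets borel"
  unfolding circ_arc_def frac_def by measurable

abbreviation "unit_measure \<equiv> restrict_space lborel {0..<1::real}"

lemma prob_space_unit: "prob_space unit_measure"
  by (intro prob_space_restrict_space) auto

lemma circ_arc_sets: "circ_arc c w \<in> sets unit_measure"
  using circ_arc_subset_unit by (subst sets_restrict_space_iff) auto

lemma measure_arc:
  assumes "0 \<le> w" "w \<le> 1"
  shows "measure unit_measure (circ_arc c w) = w"
proof -
  define r where "r = frac (c - w / 2)"
  have r: "0 \<le> r" "r < 1"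
    by (auto simp: r_def frac_lt_1)
  have fin: "emeasure lborel {0..<r + w - 1} \<noteq> \<infinity>"
    by (cases "0 \<le> r + w - 1") auto
  have "measure unit_measure (circ_arc c w) = measure lborel (circ_arc c w)"
    by (intro measure_restrict_space) (auto simp: circ_arc_def)
  also have "\<dots> = measure lborel {r..<min 1 (r + w)} + measure lborel {0..<r + w - 1}"
    unfolding circ_arc_altdef[OF assms] r_def[symmetric] using assms r fin
    by (intro measure_Union) auto
  also have "\<dots> = w"
    using assms r by (cases "r + w \<le> 1") auto
  finally show ?thesis .
qed

text \<open>The arc of width \<open>1 - w\<close> around the antipode starts at
  \<open>c + w / 2\<close>, just where the other arc ends.\<close>

lemma circ_arc_complement:
  assumes "0 \<le> w"
  shows "circ_arc (c + 1/2) (1 - w) \<inter> circ_arc c w = {}"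
proof -
  have "\<not> frac (u - (c - w / 2)) < w" if "frac (u - (c + 1/2 - (1 - w) / 2)) < 1 - w" for u
  proof -
    define f where "f = frac (u - (c + w / 2))"
    have "c + 1/2 - (1 - w) / 2 = c + w / 2"
      by (simp add: diff_divide_distrib)
    then have f: "0 \<le> f" "f < 1 - w"
      using that by (simp_all only: f_def frac_ge_0)
    have "u - (c - w / 2) = f + w + of_int \<lfloor>u - (c + w / 2)\<rfloor>"
      by (simp add: f_def frac_def)
    then have "frac (u - (c - w / 2)) = frac (f + w)"
      by (metis frac_add_of_int_right)
    also have "\<dots> = f + w"
      using f assms by (intro frac_eq[THEN iffD2]) auto
    finally show ?thesis
      using f by simp
  qed
  then show ?thesis
    by (auto simp: circ_arc_def)
qed

text \<open>The bound on the centres says that the inner arc starts no earlier and ends no later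
  than the outer one. As \<open>w \<le> 1\<close>, no wraparound occurs when distances are measured
  from the outer start.\<close>

lemma circ_arc_subset:
  assumes "0 \<le> v" "w \<le> 1" "\<bar>d - c - of_int k\<bar> \<le> (w - v) / 2"
  shows "circ_arc d v \<subseteq> circ_arc c w"
proof
  fix u
  assume u: "u \<in> circ_arc d v"
  define \<tau> where "\<tau> = (d - v / 2) - of_int k - (c - w / 2)"
  have \<tau>: "0 \<le> \<tau>" "\<tau> + v \<le> w"
    using assms(3) unfolding \<tau>_def by (auto simp: abs_le_iff diff_divide_distrib)
  define f where "f = frac (u - (d - v / 2))"
  have f: "0 \<le> f" "f < v"
    using u by (auto simp: f_def circ_arc_def)
  have "u - (c - w / 2) = f + \<tau> + of_int (\<lfloor>u - (d - v / 2)\<rfloor> + k)"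
    by (simp add: f_def \<tau>_def frac_def)
  then have "frac (u - (c - w / 2)) = frac (f + \<tau>)"
    by (metis frac_add_of_int_right)
  also have "\<dots> = f + \<tau>"
    using f \<tau> assms by (intro frac_eq[THEN iffD2]) auto
  finally show "u \<in> circ_arc c w"
    using u f \<tau> by (auto simp: circ_arc_def)
qed

text \<open>An arc of width \<open>v\<close> fits into both: it starts at the later of the two
  starting points, once the second arc has been shifted by \<open>- k\<close>.\<close>

lemma circ_arc_overlap:
  assumes v: "0 \<le> v" "v \<le> w" "v \<le> w'" and w: "w \<le> 1" "w' \<le> 1"
    and k: "\<bar>c' - c - of_int k\<bar> \<le> (w + w') / 2 - v"
  shows "v \<le> measure unit_measure (circ_arc c w \<inter> circ_arc c' w')"
proof -
  interpret prob_space unit_measure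
    by (rule prob_space_unit)
  define r where "r = max (c - w / 2) (c' - of_int k - w' / 2)"
  define d where "d = r + v / 2"
  have "r = c - w / 2 \<and> c' - of_int k - w' / 2 \<le> r \<or> r = c' - of_int k - w' / 2 \<and> c - w / 2 \<le> r"
    by (auto simp: r_def max_def)
  then have "\<bar>d - c - of_int 0\<bar> \<le> (w - v) / 2" "\<bar>d - c' - of_int (- k)\<bar> \<le> (w' - v) / 2"
    using v k unfolding d_def of_int_0 of_int_minus
      diff_divide_distrib add_divide_distrib by - (elim disjE conjE; linarith)+
  then have "circ_arc d v \<subseteq> circ_arc c w \<inter> circ_arc c' w'"
    using circ_arc_subset[of v w d c 0] circ_arc_subset[of v w' d c' "- k"] v w by auto
  then have "measure unit_measure (circ_arc d v) \<le> measure unit_measure (circ_arc c w \<inter> circ_arc c' w')"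
    by (intro finite_measure_mono) (auto simp: circ_arc_sets)
  then show ?thesis
    using measure_arc[of v d] v w by simp
qed

text \<open>The complement of the second arc is centred at the antipode of \<open>c'\<close>, and by
  the lower bound it takes up at least \<open>w - v\<close> of the first arc.\<close>

lemma circ_arc_overlap_upper:
  assumes v: "0 \<le> v" "v \<le> w" "v \<le> w'" "w + w' - v \<le> 1" and w: "w \<le> 1" "w' \<le> 1"
    and k: "\<bar>c' - c - of_int k - 1/2\<bar> \<le> 1/2 - ((w + w') / 2 - v)"
  shows "measure unit_measure (circ_arc c w \<inter> circ_arc c' w') \<le> v"
proof -
  interpret prob_space unit_measure
    by (rule prob_space_unit)
  \<comment> \<open>\<open>k + 1\<close> compensates for moving the centre by 1/2, and
    \<open>w + w' - v \<le> 1\<close> says that \<open>w - v\<close> is at most the width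
    \<open>1 - w'\<close>.\<close>
  have "w - v \<le> measure unit_measure (circ_arc c w \<inter> circ_arc (c' + 1/2) (1 - w'))"
    using assms by (intro circ_arc_overlap[where k = "k + 1"]) (auto simp: abs_le_iff field_simps)
  also have "\<dots> \<le> measure unit_measure (circ_arc c w - circ_arc c' w')"
    using circ_arc_complement[of w' c'] v by (intro finite_measure_mono) (auto simp: circ_arc_sets)
  also have "\<dots> = w - measure unit_measure (circ_arc c w \<inter> circ_arc c' w')"
    using finite_measure_Diff'[of "circ_arc c w" "circ_arc c' w'"] measure_arc[of w c] v w
    by (auto simp: circ_arc_sets)
  finally show ?thesis
    by simp
qed

subsection \<open>The two envelopes\<close>

text \<open>The joint probability of each edge errs from \<open>y $ e\<close> in the direction of
  the sign of \<open>a e\<close>, so no term of the sum decreases.\<close>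

lemma exists_hull_point_above:
  fixes E :: "'n::finite set set" and a :: "'n set \<Rightarrow> real"
  assumes E: "cactus E"
    and box: "(x, y) \<in> unit_box E" and mc: "mccormick E x y"
    and cyc: "\<And>C D. C \<in> cycles E \<Longrightarrow> D = {e \<in> C. a e < 0} \<Longrightarrow> odd (card D) \<Longrightarrow> cycle_inequality C D x y"
  obtains z where "(x, z) \<in> hull_graph (quad_fun E a)" "(\<Sum>e\<in>E. a e * y $ e) \<le> z"
proof -
  define D where "D = {e. a e < 0}"
  have x: "0 \<le> x $ i" "x $ i \<le> 1" for i
    using box by (auto simp: unit_box_def)
  have edge: "\<exists>i j. e = {i, j} \<and> i \<noteq> j" if "e \<in> E" for e
    using E that by (metis cactus_def simple_graph_def card_2_iff)
  have ineqs: "0 \<le> y $ {i, j}" "y $ {i, j} \<le> x $ i" "y $ {i, j} \<le> x $ j"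
      "x $ i + x $ j - y $ {i, j} \<le> 1" if "{i, j} \<in> E" for i j
    using mc that by (auto simp: mccormick_def)
  have slack_edge: "slack D x y {i, j} = (if {i, j} \<in> D then 1/2 - ((x $ i + x $ j) / 2 - y $ {i, j})
      else (x $ i + x $ j) / 2 - y $ {i, j})" if "i \<noteq> j" for i j
    using that by (simp add: slack_def)
  \<comment> \<open>Off \<open>D\<close> this follows from the two upper bounds on
    \<open>y $ e\<close>; in \<open>D\<close>, from the other two McCormick inequalities.\<close>
  have "0 \<le> slack D x y e" if "e \<in> E" for e
  proof -
    obtain i j where ij: "e = {i, j}" "i \<noteq> j"
      using edge \<open>e \<in> E\<close> by blast
    then show ?thesis
      using ineqs[of i j] that unfolding ij(1) slack_edge[OF ij(2)] add_divide_distrib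
      by - (cases "{i, j} \<in> D"; simp; linarith)
  qed
  moreover have "1/2 \<le> (\<Sum>e\<in>C. slack D x y e)" if C: "C \<in> cycles E" "odd (card (C \<inter> D))" for C
  proof -
    obtain vs where vs: "distinct vs" "3 \<le> length vs" "C = closed_walk_edges vs"
      using C by (auto simp: cycles_def)
    then interpret cycle_list vs
      by unfold_locales
    have "cycle_inequality C (C \<inter> D) x y"
      using C by (intro cyc) (auto simp: D_def)
    then have "1/2 \<le> (\<Sum>e\<in>C. slack (C \<inter> D) x y e)"
      using cycle_inequality_iff_slack[of "C \<inter> D"] vs(3) by auto
    then show ?thesis
      by (simp add: slack_Int)
  qed
  ultimately obtain \<theta> where \<theta>: "placed E D (slack D x y) \<theta>"
    using exists_placed[OF E] by blast
  define S where "S i = circ_arc (\<theta> i) (x $ i)" for i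
  define p where "p e = measure unit_measure {\<omega> \<in> space unit_measure. \<forall>i\<in>e. \<omega> \<in> S i}" for e
  have "a e * y $ e \<le> a e * p e" if e: "e \<in> E" for e
  proof -
    obtain i j where ij: "e = {i, j}" "i \<noteq> j"
      using edge e by blast
    have "{\<omega> \<in> space unit_measure. \<forall>i\<in>e. \<omega> \<in> S i} = S i \<inter> S j"
      using ij by (auto simp: S_def circ_arc_def space_restrict_space)
    then have p: "p e = measure unit_measure (S i \<inter> S j)"
      by (simp add: p_def)
    obtain k :: int where k: "\<bar>\<theta> j - \<theta> i - k - (if e \<in> D then 1/2 else 0)\<bar> \<le> slack D x y e"
      using \<theta> e ij by (auto simp: placed_def)
    show ?thesis
    proof (cases "e \<in> D")
      case True
      then have "p e \<le> y $ e"
        using k ij e ineqs[of i j] x unfolding p S_def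
        by (intro circ_arc_overlap_upper[where k = k]) (auto simp: slack_edge)
      then show ?thesis
        using True by (intro mult_left_mono_neg) (auto simp: D_def)
    next
      case False
      then have "y $ e \<le> p e"
        using k ij e ineqs[of i j] x unfolding p S_def
        by (intro circ_arc_overlap[where k = k]) (auto simp: slack_edge)
      then show ?thesis
        using False by (intro mult_left_mono) (auto simp: D_def)
    qed
  qed
  then have "(\<Sum>e\<in>E. a e * y $ e) \<le> (\<Sum>e\<in>E. a e * p e)"
    by (rule sum_mono)
  moreover have "(\<chi> i. measure unit_measure (S i), \<Sum>e\<in>E. a e * p e) \<in> hull_graph (quad_fun E a)"
    unfolding p_def by (intro random_set_in_hull_graph prob_space_unit) (simp add: S_def circ_arc_sets)
  moreover have "(\<chi> i. measure unit_measure (S i)) = x"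
    using x by (simp add: vec_eq_iff S_def measure_arc)
  ultimately show ?thesis
    using that by simp
qed

lemma hull_graph_uminus:
  "hull_graph (\<lambda>x. - f x) = (\<lambda>(x, z). (x, - z)) ` hull_graph f"
proof -
  have "linear (\<lambda>(x :: real ^ 'n, z :: real). (x, - z))"
    by (intro linearI) auto
  then have "(\<lambda>(x, z). (x, - z)) ` hull_graph f
      = convex hull ((\<lambda>(x, z). (x, - z)) ` {(x, z). (\<forall>i. 0 \<le> x $ i \<and> x $ i \<le> 1) \<and> z = f x})"
    unfolding hull_graph_def by (rule convex_hull_linear_image)
  also have "(\<lambda>(x, z). (x, - z)) ` {(x, z). (\<forall>i. 0 \<le> x $ i \<and> x $ i \<le> 1) \<and> z = f x}
      = {(x, z). (\<forall>i. 0 \<le> x $ i \<and> x $ i \<le> 1) \<and> z = - f x}"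
    by (auto simp: image_iff)
  finally show ?thesis
    by (simp add: hull_graph_def)
qed

text \<open>Negating the weights reflects the hull and exchanges positive and negative
  edges.\<close>

lemma exists_hull_point_below:
  fixes E :: "'n::finite set set" and a :: "'n set \<Rightarrow> real"
  assumes E: "cactus E"
    and box: "(x, y) \<in> unit_box E" and mc: "mccormick E x y"
    and cyc: "\<And>C D. C \<in> cycles E \<Longrightarrow> D = {e \<in> C. 0 < a e} \<Longrightarrow> odd (card D) \<Longrightarrow> cycle_inequality C D x y"
  obtains z where "(x, z) \<in> hull_graph (quad_fun E a)" "z \<le> (\<Sum>e\<in>E. a e * y $ e)"
proof -
  have eq: "quad_fun E (\<lambda>e. - a e) = (\<lambda>x. - quad_fun E a x)"
    by (auto simp: quad_fun_def sum_negf)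
  obtain z where "(x, z) \<in> hull_graph (quad_fun E (\<lambda>e. - a e))" "(\<Sum>e\<in>E. - a e * y $ e) \<le> z"
    by (rule exists_hull_point_above[where a = "\<lambda>e. - a e" and x = x and y = y and E = E])
      (use assms in auto)
  then show ?thesis
    using that[of "- z"] unfolding eq hull_graph_uminus by (auto simp: sum_negf)
qed

text \<open>The products \<open>x $ i * x $ j\<close> lift a graph point into the polytope for every
  choice of \<open>Q\<close>, because they satisfy all cycle inequalities.\<close>

lemma graph_point_in_polytope:
  fixes x :: "real ^ 'n::finite"
  assumes E: "cactus E" and Q: "Q \<subseteq> cycle_ineq_indices E"
    and x: "\<And>i. 0 \<le> x $ i \<and> x $ i \<le> 1"
  shows "(x, \<chi> e. if e \<in> E then \<Prod>i\<in>e. x $ i else 0) \<in> described_polytope E Q" (is "(x, ?y) \<in> _")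
proof -
  have "mccormick E x ?y"
    unfolding mccormick_def
  proof (intro allI impI)
    fix i j
    assume ij: "{i, j} \<in> E"
    then have "i \<noteq> j"
      using E by (auto simp: cactus_def simple_graph_def)
    then have y: "?y $ {i, j} = x $ i * x $ j"
      using ij by simp
    \<comment> \<open>Expanded, this is the last McCormick inequality.\<close>
    have "0 \<le> (1 - x $ i) * (1 - x $ j)"
      using x by (intro mult_nonneg_nonneg) auto
    then show "0 \<le> ?y $ {i, j} \<and> ?y $ {i, j} \<le> x $ i \<and> ?y $ {i, j} \<le> x $ j \<and>
        x $ i + x $ j - ?y $ {i, j} \<le> 1"
      unfolding y using x by (auto simp: algebra_simps mult_left_le mult_left_le_one_le)
  qed
  moreover have "cycle_inequality C D x ?y" if "(C, D) \<in> Q" for C D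
  proof -
    have CD: "C \<in> cycles E" "D \<subseteq> C" "odd (card D)"
      using that Q by (auto simp: cycle_ineq_indices_def)
    then obtain vs where vs: "distinct vs" "3 \<le> length vs" "C = closed_walk_edges vs" "C \<subseteq> E"
      by (auto simp: cycles_def)
    then interpret cycle_list vs
      by unfold_locales
    show ?thesis
      unfolding vs(3) by (intro cycle_inequality_prod) (use CD vs x in auto)
  qed
  ultimately show ?thesis
    using x by (auto simp: described_polytope_def unit_box_def intro!: prod_nonneg prod_le_1)
qed

theorem theorem3:
  fixes E :: "'n::finite set set" and a :: "'n set \<Rightarrow> real" and k :: nat
  assumes "cactus E"
    and "card (cycles E) = k"
    and "\<forall>e\<in>E. a e \<noteq> 0"
  shows "\<exists>P Q. polytope P \<and> Q \<subseteq> cycle_ineq_indices E \<and> card Q \<le> 2 * k \<and>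
    P = described_polytope E Q \<and>
    hull_graph (quad_fun E a) = proj_map E a ` P"
proof -
  \<comment> \<open>Each cycle contributes at most two sets \<open>D\<close>: its negative edges for
    the upper envelope and its positive edges for the lower one.\<close>
  define Q where "Q = {(C, D). C \<in> cycles E \<and> odd (card D) \<and>
    (D = {e \<in> C. a e < 0} \<or> D = {e \<in> C. 0 < a e})}"
  let ?P = "described_polytope E Q"
  have Q: "Q \<subseteq> cycle_ineq_indices E"
    by (auto simp: Q_def cycle_ineq_indices_def)
  have "card Q \<le> card ((\<lambda>C. (C, {e \<in> C. a e < 0})) ` cycles E \<union> (\<lambda>C. (C, {e \<in> C. 0 < a e})) ` cycles E)"
    by (intro card_mono) (auto simp: Q_def)
  also have "\<dots> \<le> card (cycles E) + card (cycles E)"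
    by (intro order_trans[OF card_Un_le] add_mono card_image_le) auto
  finally have card: "card Q \<le> 2 * k"
    using assms(2) by simp
  have P: "polytope ?P"
    by (rule polytope_described_polytope)
  have "hull_graph (quad_fun E a) \<subseteq> proj_map E a ` ?P"
    unfolding hull_graph_def
  proof (rule hull_minimal)
    show "{(x, z). (\<forall>i. 0 \<le> x $ i \<and> x $ i \<le> 1) \<and> z = quad_fun E a x} \<subseteq> proj_map E a ` ?P"
    proof clarify
      fix x :: "real ^ 'n"
      assume "\<forall>i. 0 \<le> x $ i \<and> x $ i \<le> 1"
      then show "(x, quad_fun E a x) \<in> proj_map E a ` ?P"
        by (intro image_eqI[OF _ graph_point_in_polytope[OF assms(1) Q]])
          (auto simp: proj_map_def quad_fun_def intro!: sum.cong)
    qed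
    show "convex (proj_map E a ` ?P)"
      by (intro convex_linear_image linear_proj_map polytope_imp_convex P)
  qed
  moreover have "proj_map E a (x, y) \<in> hull_graph (quad_fun E a)" if "(x, y) \<in> ?P" for x y
  proof -
    let ?z = "\<Sum>e\<in>E. a e * y $ e"
    have xy: "(x, y) \<in> unit_box E" "mccormick E x y"
        "\<And>C D. (C, D) \<in> Q \<Longrightarrow> cycle_inequality C D x y"
      using that by (auto simp: described_polytope_def)
    obtain z1 where z1: "(x, z1) \<in> hull_graph (quad_fun E a)" "?z \<le> z1"
      by (rule exists_hull_point_above[OF assms(1) xy(1,2), where a = a])
        (auto intro!: xy(3) simp: Q_def)
    obtain z2 where z2: "(x, z2) \<in> hull_graph (quad_fun E a)" "z2 \<le> ?z"
      by (rule exists_hull_point_below[OF assms(1) xy(1,2), where a = a])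
        (auto intro!: xy(3) simp: Q_def)
    \<comment> \<open>The projected point lies on the vertical segment between two hull points,
      hence in the hull by convexity.\<close>
    have "?z \<in> closed_segment z2 z1"
      using z1(2) z2(2) by (auto simp: closed_segment_eq_real_ivl)
    then obtain t where t: "0 \<le> t" "t \<le> 1" "?z = (1 - t) * z2 + t * z1"
      by (auto simp: in_segment)
    have "(1 - t) *\<^sub>R (x, z2) + t *\<^sub>R (x, z1) \<in> hull_graph (quad_fun E a)"
      using z1 z2 t by (intro convexD) (auto simp: hull_graph_def)
    moreover have "(1 - t) *\<^sub>R (x, z2) + t *\<^sub>R (x, z1) = (x, ?z)"
      by (simp add: t(3) scaleR_left_distrib[symmetric])
    ultimately show ?thesis
      by (simp add: proj_map_def)
  qed
  ultimately have "hull_graph (quad_fun E a) = proj_map E a ` ?P"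
    by auto
  then show ?thesis
    using P Q card by blast
qed

end
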